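(* Let $m\ge 2$ and let $c$ be a Coxeter element of the dihedral group $I_2(m)$ of order $2m$. Fix $p\in(0,1]$. Then \[\mathcal E(\mathrm{Camb}_c)=\frac{1+m(1-p)}{2p-p^2}.\]
   Context: $I_2(m)$ is the Coxeter group with simple reflections $s,t$ and $(st)^m=e$. Its Coxeter elements are $st$ and $ts$. The right weak order: $u\le v$ if some reduced word for $v$ has a reduced word for $u$ as a prefix. For a word $\mathsf c$ for $c$, the $\mathsf c$-sorting word of $w$ is the reduced word for $w$ that is lexicographically first (by positions) among reduced words for $w$ occurring as subwords of $\mathsf c^\infty$; writing it as $\mathsf w^{\langle1\rangle}\mathsf w^{\langle2\rangle}\cdots$ with $\mathsf w^{\langle i\rangle}$ taken from the $i$-th copy of $\mathsf c$, $w$ is $c$-sortable if the letter sets of the $\mathsf w^{\langle i\rangle}$ are weakly decreasing under inclusion. $\mathrm{Camb}_c$ is the lattice of $c$-sortable elements under the weak order. For a finite lattice $L$, the Ungarian Markov chain (probability $p$) moves from $x$ to $\bigwedge(\{x\}\cup T)$, where $T$ contains each element covered by $x$ independently with probability $p$; $\mathcal E(L)$ is the expected number of steps from the top element to the bottom element. *)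

theory Defs
  imports "HOL-Algebra.Generated_Groups" "HOL-Algebra.Lattice" "HOL-Probability.Probability"
begin

section \<open>Coxeter systems\<close>

definition word_val :: "('a, 'b) monoid_scheme \<Rightarrow> 'a list \<Rightarrow> 'a" where
  "word_val G u = foldr (\<lambda>x y. x \<otimes>\<^bsub>G\<^esub> y) u \<one>\<^bsub>G\<^esub>"

text \<open>Entry \<open>0\<close> of a Coxeter matrix stands for \<open>\<infinity>\<close> (no relation).\<close>

definition coxeter_matrix :: "'a set \<Rightarrow> ('a \<Rightarrow> 'a \<Rightarrow> nat) \<Rightarrow> bool" where
  "coxeter_matrix S M \<longleftrightarrow>
     (\<forall>s\<in>S. M s s = 1) \<and> (\<forall>s\<in>S. \<forall>t\<in>S. M s t = M t s \<and> (s \<noteq> t \<longrightarrow> M s t \<noteq> 1))"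

text \<open>
  The congruence on words over \<open>S\<close> generated by \<open>(st)\<^bsup>M s t\<^esup> = 1\<close>. The relations include
  \<open>s\<^sup>2 = 1\<close>, so no formal inverses are needed: the quotient monoid is the Coxeter group
  \<open>\<langle>S | (st)\<^bsup>M s t\<^esup> = 1\<rangle>\<close>.
\<close>

inductive coxeter_cong :: "'a set \<Rightarrow> ('a \<Rightarrow> 'a \<Rightarrow> nat) \<Rightarrow> 'a list \<Rightarrow> 'a list \<Rightarrow> bool"
  for S :: "'a set" and M :: "'a \<Rightarrow> 'a \<Rightarrow> nat" where
  cong_relation: "s \<in> S \<Longrightarrow> t \<in> S \<Longrightarrow>
    coxeter_cong S M (u @ concat (replicate (M s t) [s, t]) @ v) (u @ v)"
| cong_refl: "coxeter_cong S M u u"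
| cong_sym: "coxeter_cong S M u v \<Longrightarrow> coxeter_cong S M v u"
| cong_trans: "coxeter_cong S M u v \<Longrightarrow> coxeter_cong S M v w \<Longrightarrow> coxeter_cong S M u w"

text \<open>
  \<open>G\<close> is the group presented by the Coxeter matrix, via the inclusion of \<open>S\<close> in \<open>G\<close>: the set
  \<open>S\<close> generates \<open>G\<close>, and two words have the same value exactly when the defining relations
  force it.
\<close>

definition coxeter_system ::
    "('a, 'b) monoid_scheme \<Rightarrow> 'a set \<Rightarrow> ('a \<Rightarrow> 'a \<Rightarrow> nat) \<Rightarrow> bool" where
  "coxeter_system G S M \<longleftrightarrow>
     group G \<and> S \<subseteq> carrier G \<and> generate G S = carrier G \<and> coxeter_matrix S M \<and>
     (\<forall>u\<in>lists S. \<forall>v\<in>lists S. word_val G u = word_val G v \<longleftrightarrow> coxeter_cong S M u v)"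

definition dihedral_coxeter_system ::
    "nat \<Rightarrow> ('a, 'b) monoid_scheme \<Rightarrow> 'a \<Rightarrow> 'a \<Rightarrow> bool" where
  "dihedral_coxeter_system m G s t \<longleftrightarrow>
     s \<noteq> t \<and> coxeter_system G {s, t} (\<lambda>x y. if x = y then 1 else m)"

definition reduced_word :: "('a, 'b) monoid_scheme \<Rightarrow> 'a set \<Rightarrow> 'a \<Rightarrow> 'a list \<Rightarrow> bool" where
  "reduced_word G S w u \<longleftrightarrow>
     u \<in> lists S \<and> word_val G u = w \<and>
     (\<forall>v\<in>lists S. word_val G v = w \<longrightarrow> length u \<le> length v)"

definition right_weak_le :: "('a, 'b) monoid_scheme \<Rightarrow> 'a set \<Rightarrow> 'a \<Rightarrow> 'a \<Rightarrow> bool" where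
  "right_weak_le G S u v \<longleftrightarrow> (\<exists>a b. reduced_word G S v (a @ b) \<and> reduced_word G S u a)"

definition coxeter_element :: "('a, 'b) monoid_scheme \<Rightarrow> 'a set \<Rightarrow> 'a \<Rightarrow> bool" where
  "coxeter_element G S c \<longleftrightarrow> (\<exists>u. distinct u \<and> set u = S \<and> word_val G u = c)"


section \<open>Sortable elements and the Cambrian lattice\<close>

text \<open>
  The infinite word \<open>cw\<^sup>\<infinity>\<close> has letter \<open>cw ! (i mod length cw)\<close> at position \<open>i\<close>, which lies in
  copy number \<open>i div length cw\<close> of \<open>cw\<close> (copies are numbered from \<open>0\<close>).
  A subword is given by its strictly increasing list of positions.
\<close>

definition reduced_subword ::
    "('a, 'b) monoid_scheme \<Rightarrow> 'a set \<Rightarrow> 'a list \<Rightarrow> 'a \<Rightarrow> nat list \<Rightarrow> bool" where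
  "reduced_subword G S cw w ps \<longleftrightarrow>
     sorted_wrt (<) ps \<and> reduced_word G S w (map (\<lambda>i. cw ! (i mod length cw)) ps)"

definition sorting_positions ::
    "('a, 'b) monoid_scheme \<Rightarrow> 'a set \<Rightarrow> 'a list \<Rightarrow> 'a \<Rightarrow> nat list \<Rightarrow> bool" where
  "sorting_positions G S cw w ps \<longleftrightarrow>
     reduced_subword G S cw w ps \<and>
     (\<forall>qs. reduced_subword G S cw w qs \<longrightarrow> ps = qs \<or> (ps, qs) \<in> lexord {(i, j). i < j})"

definition copy_letters :: "'a list \<Rightarrow> nat list \<Rightarrow> nat \<Rightarrow> 'a set" where
  "copy_letters cw ps k = {cw ! (i mod length cw) | i. i \<in> set ps \<and> i div length cw = k}"

definition sortable :: "('a, 'b) monoid_scheme \<Rightarrow> 'a set \<Rightarrow> 'a list \<Rightarrow> 'a \<Rightarrow> bool" where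
  "sortable G S cw w \<longleftrightarrow>
     w \<in> carrier G \<and>
     (\<exists>ps. sorting_positions G S cw w ps \<and>
           (\<forall>k. copy_letters cw ps (Suc k) \<subseteq> copy_letters cw ps k))"

definition camb :: "('a, 'b) monoid_scheme \<Rightarrow> 'a set \<Rightarrow> 'a list \<Rightarrow> 'a gorder" where
  "camb G S cw =
     \<lparr>carrier = {w. sortable G S cw w}, eq = (=), le = right_weak_le G S\<rparr>"


section \<open>Markov chains and hitting times\<close>

definition mc_kernel :: "('a \<Rightarrow> 'a pmf) \<Rightarrow> 'a \<Rightarrow> nat \<Rightarrow> (nat \<Rightarrow> 'a) \<Rightarrow> 'a measure" where
  "mc_kernel K x n \<omega> = measure_pmf (case n of 0 \<Rightarrow> return_pmf x | Suc k \<Rightarrow> K (\<omega> k))"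

text \<open>
  The law on trajectories of the time-homogeneous Markov chain with transition kernel \<open>K\<close>
  started in \<open>x\<close>, provided by the Ionescu Tulcea theorem.
\<close>

definition markov_chain :: "('a \<Rightarrow> 'a pmf) \<Rightarrow> 'a \<Rightarrow> (nat \<Rightarrow> 'a) measure" where
  "markov_chain K x =
     projective_family.lim UNIV
       (Ionescu_Tulcea.CI (mc_kernel K x) (\<lambda>_. count_space UNIV)) (\<lambda>_. count_space UNIV)"

lemma Ionescu_Tulcea_mc_kernel: "Ionescu_Tulcea (mc_kernel K x) (\<lambda>_. count_space UNIV)"
proof (rule Ionescu_Tulcea.intro)
  fix i
  show "mc_kernel K x i \<in> measurable (PiM {0..<i} (\<lambda>_. count_space UNIV))
                            (subprob_algebra (count_space UNIV))"
  proof (cases i)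
    case 0
    then show ?thesis
      by (simp add: mc_kernel_def[abs_def] measure_pmf_in_subprob_space space_subprob_algebra
          subprob_space_measure_pmf)
  next
    case (Suc k)
    have "(\<lambda>\<omega>. measure_pmf (K (\<omega> k))) \<in> measurable (PiM {0..<i} (\<lambda>_. count_space UNIV))
            (subprob_algebra (count_space UNIV))"
      by (rule measurable_compose[OF measurable_component_singleton[of k "{0..<i}"]])
         (auto simp: Suc space_subprob_algebra subprob_space_measure_pmf)
    then show ?thesis by (simp add: mc_kernel_def[abs_def] Suc)
  qed
qed (simp add: mc_kernel_def measure_pmf.prob_space_axioms)

lemma emeasure_markov_chain_path:
  "emeasure (markov_chain K x) {\<omega>. \<forall>i\<le>n. \<omega> i = xs i} =
     ennreal (of_bool (xs 0 = x) * (\<Prod>i<n. pmf (K (xs i)) (xs (Suc i))))"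
proof -
  interpret IT: Ionescu_Tulcea "mc_kernel K x" "\<lambda>_. count_space UNIV"
    by (rule Ionescu_Tulcea_mc_kernel)
  let ?M = "\<lambda>_::nat. count_space (UNIV :: 'a set)"
  define X where "X k = PiE {0..<k} (\<lambda>i. {xs i})" for k
  have X_sets [measurable]: "X k \<in> sets (PiM {0..<k} ?M)" for k
    unfolding X_def by (intro sets_PiM_I_finite) auto
  have u: "(\<lambda>_. undefined) \<in> space (PiM {0..<0} ?M)"
    by (simp add: space_PiM)
  have eP: "emeasure (IT.eP k \<omega>) (X (Suc k)) =
      emeasure (mc_kernel K x k xs) {xs k} * indicator (X k) \<omega>"
    if \<omega>: "\<omega> \<in> space (PiM {0..<k} ?M)" for k \<omega>
  proof -
    have ext: "\<omega> \<in> extensional {0..<k}" using \<omega> by (simp add: space_PiM PiE_iff)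
    have pre: "(\<lambda>y. fun_upd \<omega> k y) -` X (Suc k) = (if \<omega> \<in> X k then {xs k} else {})"
      using ext by (auto simp: X_def PiE_iff extensional_def atLeast0_lessThan_Suc split: if_splits)
    have ker: "mc_kernel K x k \<omega> = mc_kernel K x k xs" if "\<omega> \<in> X k"
      using that by (auto simp: mc_kernel_def X_def PiE_iff split: nat.splits)
    show ?thesis
      by (subst IT.emeasure_eP[OF \<omega> X_sets]) (auto simp: pre ker split: split_indicator)
  qed
  have C: "emeasure (IT.C 0 k (\<lambda>_. undefined)) (X k) =
      (\<Prod>i<k. emeasure (mc_kernel K x i xs) {xs i})" for k
  proof (induction k)
    case 0
    have "emeasure (return (PiM {0..<0} ?M) (\<lambda>_. undefined)) (X 0) = indicator (X 0) (\<lambda>_. undefined)"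
      by (rule emeasure_return[OF X_sets])
    then show ?case by (simp add: X_def)
  next
    case (Suc k)
    have sp: "space (IT.C 0 k (\<lambda>_. undefined)) = space (PiM {0..<k} ?M)"
      using IT.space_C[OF u, of k] by simp
    have se: "sets (IT.C 0 k (\<lambda>_. undefined)) = sets (PiM {0..<k} ?M)"
      using IT.sets_C[OF u, of k] by simp
    have ne: "space (IT.C 0 k (\<lambda>_. undefined)) \<noteq> {}"
      using prob_space.not_empty[OF IT.prob_space_C[OF u]] .
    have "emeasure (IT.C 0 (Suc k) (\<lambda>_. undefined)) (X (Suc k)) =
        (\<integral>\<^sup>+ \<omega>. emeasure (IT.eP k \<omega>) (X (Suc k)) \<partial>IT.C 0 k (\<lambda>_. undefined))"
      using emeasure_bind[OF ne _ X_sets, of "IT.eP k"] IT.measurable_eP[of k]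
      by (simp add: measurable_cong_sets[OF se refl])
    also have "\<dots> = (\<integral>\<^sup>+ \<omega>. emeasure (mc_kernel K x k xs) {xs k} * indicator (X k) \<omega>
        \<partial>IT.C 0 k (\<lambda>_. undefined))"
      by (rule nn_integral_cong) (simp add: eP sp)
    also have "\<dots> = emeasure (mc_kernel K x k xs) {xs k} * emeasure (IT.C 0 k (\<lambda>_. undefined)) (X k)"
      by (rule nn_integral_cmult_indicator) (simp add: se)
    finally show ?case by (simp add: Suc mult.commute)
  qed
  have path: "{\<omega>. \<forall>i\<le>n. \<omega> i = xs i} = IT.PF.emb UNIV {0..<Suc n} (X (Suc n))"
    by (auto simp: prod_emb_def X_def PiE_iff less_Suc_eq_le)
  have "emeasure (markov_chain K x) {\<omega>. \<forall>i\<le>n. \<omega> i = xs i} =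
      emeasure (IT.CI {0..<Suc n}) (X (Suc n))"
    unfolding markov_chain_def path by (rule IT.lim) auto
  also have "\<dots> = emeasure (IT.C 0 (Suc n) (\<lambda>_. undefined)) (X (Suc n))"
    by (subst IT.emeasure_CI[of _ "Suc n"]) (auto simp: prod_emb_id X_def PiE_iff)
  also have "\<dots> = (\<Prod>i<Suc n. emeasure (mc_kernel K x i xs) {xs i})"
    by (rule C)
  also have "\<dots> = emeasure (return_pmf x) {xs 0} *
      (\<Prod>i<n. ennreal (pmf (K (xs i)) (xs (Suc i))))"
    by (subst prod.lessThan_Suc_shift) (simp add: mc_kernel_def emeasure_pmf_single)
  also have "\<dots> = ennreal (of_bool (xs 0 = x) * (\<Prod>i<n. pmf (K (xs i)) (xs (Suc i))))"
    by (simp add: emeasure_pmf_single prod_ennreal ennreal_mult' prod_nonneg of_bool_def)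
  finally show ?thesis .
qed

text \<open>The hitting time is \<open>\<infinity>\<close> on trajectories that never reach \<open>b\<close>.\<close>

definition hitting_time :: "'a \<Rightarrow> (nat \<Rightarrow> 'a) \<Rightarrow> ennreal" where
  "hitting_time b \<omega> = (if \<exists>n. \<omega> n = b then of_nat (LEAST n. \<omega> n = b) else \<infinity>)"


section \<open>Ungarian Markov chains\<close>

definition covers :: "('a, 'b) gorder_scheme \<Rightarrow> 'a \<Rightarrow> 'a \<Rightarrow> bool" where
  "covers L x y \<longleftrightarrow>
     x \<in> carrier L \<and> y \<in> carrier L \<and> y \<sqsubset>\<^bsub>L\<^esub> x \<and> \<not> (\<exists>z\<in>carrier L. y \<sqsubset>\<^bsub>L\<^esub> z \<and> z \<sqsubset>\<^bsub>L\<^esub> x)"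

text \<open>
  Meaningful for finite \<open>A\<close>: every element is selected independently with probability \<open>p\<close>.
  The default value \<open>False\<close> only concerns elements outside \<open>A\<close>.
\<close>

definition random_subset :: "real \<Rightarrow> 'a set \<Rightarrow> 'a set pmf" where
  "random_subset p A = map_pmf (\<lambda>f. {y \<in> A. f y}) (Pi_pmf A False (\<lambda>_. bernoulli_pmf p))"

definition ungarian_kernel :: "('a, 'b) gorder_scheme \<Rightarrow> real \<Rightarrow> 'a \<Rightarrow> 'a pmf" where
  "ungarian_kernel L p x =
     map_pmf (\<lambda>T. \<Sqinter>\<^bsub>L\<^esub> ({x} \<union> T)) (random_subset p {y. covers L x y})"

definition ungarian_expectation :: "('a, 'b) gorder_scheme \<Rightarrow> real \<Rightarrow> ennreal" where
  "ungarian_expectation L p =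
     (\<integral>\<^sup>+ \<omega>. hitting_time \<bottom>\<^bsub>L\<^esub> \<omega> \<partial>markov_chain (ungarian_kernel L p) \<top>\<^bsub>L\<^esub>)"

end

theory Submission
  imports Defs "HOL-Number_Theory.Cong"
begin

text \<open>
  Reading words as walks on the \<open>2m\<close>-cycle shows that the reduced words are the alternating words of
  length at most \<open>m\<close>. With \<open>c = ab\<close>, the sortable elements are the prefixes of \<open>aba\<dots>\<close> together with
  \<open>b\<close>, so the Cambrian lattice is a polygon with a chain \<open>e < a < ab < \<dots> < w\<^sub>0\<close> on one side and
  \<open>e < b < w\<^sub>0\<close> on the other. First-step analysis gives the expected time \<open>k/p\<close> from the element of
  length \<open>k < m\<close> on the chain, \<open>1/p\<close> from \<open>b\<close>, and for the top element
  \<open>E = 1 + p(1-p)((m-1)/p + 1/p) + (1-p)\<^sup>2 E\<close>.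
\<close>

section \<open>Expected hitting times\<close>

text \<open>\<open>killed K A f n x\<close> is the expectation of \<open>f\<close> at time \<open>n\<close>, restricted to the event that the
  chain started in \<open>x\<close> stays in \<open>A\<close> up to time \<open>n\<close>.\<close>

primrec killed :: "('a \<Rightarrow> 'a pmf) \<Rightarrow> 'a set \<Rightarrow> ('a \<Rightarrow> ennreal) \<Rightarrow> nat \<Rightarrow> 'a \<Rightarrow> ennreal" where
  "killed K A f 0 x = f x * indicator A x"
| "killed K A f (Suc n) x = (\<integral>\<^sup>+y. killed K A f n y \<partial>measure_pmf (K x)) * indicator A x"

text \<open>The definition splits off the first step, but the path measure of Ionescu Tulcea grows
  at the end, so a recursion on the last step is needed.\<close>

lemma killed_Suc':
  "killed K A f (Suc n) x = killed K A (\<lambda>z. \<integral>\<^sup>+y. f y * indicator A y \<partial>measure_pmf (K z)) n x"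
proof (induction n arbitrary: x)
  case (Suc n)
  then have "killed K A f (Suc n) = killed K A (\<lambda>z. \<integral>\<^sup>+y. f y * indicator A y \<partial>measure_pmf (K z)) n"
    by blast
  then show ?case
    by (simp only: killed.simps(2)[of K A f "Suc n"] killed.simps(2)[of _ _ _ n])
qed simp

text \<open>The chain never leaves the closed set \<open>S\<close>, so a comparison of
  \<open>f\<close> and \<open>g\<close> on \<open>S\<close> is inherited by every step.\<close>

lemma killed_mono: "(\<And>y. y \<in> S \<Longrightarrow> f y \<le> g y) \<Longrightarrow> (\<And>y. y \<in> S \<Longrightarrow> set_pmf (K y) \<subseteq> S) \<Longrightarrow> x \<in> S \<Longrightarrow>
    killed K A f n x \<le> killed K A g n x"
proof (induction n arbitrary: x)
  case (Suc n)
  have "(\<integral>\<^sup>+y. killed K A f n y \<partial>measure_pmf (K x)) \<le> (\<integral>\<^sup>+y. killed K A g n y \<partial>measure_pmf (K x))"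
    using Suc by (intro nn_integral_mono_AE) (auto simp: AE_measure_pmf_iff)
  then show ?case
    by (auto intro: mult_right_mono)
qed (auto intro: mult_right_mono)

lemma killed_cmult: "killed K A (\<lambda>y. c * f y) n x = c * killed K A f n x"
  by (induction n arbitrary: x) (simp_all add: nn_integral_cmult mult.assoc)

text \<open>Integrating out the last coordinate replaces the integrand by its one-step average, as
  in \<open>killed_Suc'\<close>; the probability is the case of the constant function
  \<open>1\<close>.\<close>

lemma emeasure_markov_chain_stay:
  fixes K :: "'a \<Rightarrow> 'a pmf"
  shows "emeasure (markov_chain K x) {\<omega>. \<forall>i\<le>n. \<omega> i \<in> A} = killed K A (\<lambda>_. 1) n x"
proof -
  interpret IT: Ionescu_Tulcea "mc_kernel K x" "\<lambda>_. count_space UNIV"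
    by (rule Ionescu_Tulcea_mc_kernel)
  let ?M = "\<lambda>_::nat. count_space (UNIV :: 'a set)"
  define X where "X k = PiE {0..<k} (\<lambda>i. A)" for k :: nat
  have X_sets [measurable]: "X k \<in> sets (PiM {0..<k} ?M)" for k
    unfolding X_def by (intro sets_PiM_I_finite) auto
  have u: "(\<lambda>_. undefined) \<in> space (PiM {0..<0} ?M)"
    by (simp add: space_PiM)
  have meas: "(\<lambda>\<omega>. f (\<omega> k) * indicator (X (Suc k)) \<omega>) \<in> borel_measurable (PiM {0..<Suc k} ?M)"
    for f :: "'a \<Rightarrow> ennreal" and k
    by (intro borel_measurable_times_ennreal borel_measurable_indicator X_sets
        measurable_compose[OF measurable_component_singleton[of k "{0..<Suc k}"]]) auto
  \<comment> \<open>Stated for all \<open>f\<close>, because the induction step applies it to the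
    one-step average of \<open>f\<close> on \<open>A\<close>.\<close>
  have C: "(\<integral>\<^sup>+\<omega>. f (\<omega> k) * indicator (X (Suc k)) \<omega> \<partial>IT.C 0 (Suc k) (\<lambda>_. undefined)) = killed K A f k x"
    for f k
  proof (induction k arbitrary: f)
    case 0
    have "IT.C 0 (Suc 0) (\<lambda>_. undefined) = IT.eP 0 (\<lambda>_. undefined)"
      using bind_return[OF IT.measurable_eP u] by simp
    then have "(\<integral>\<^sup>+\<omega>. f (\<omega> 0) * indicator (X 1) \<omega> \<partial>IT.C 0 (Suc 0) (\<lambda>_. undefined)) =
        (\<integral>\<^sup>+\<omega>. f (\<omega> 0) * indicator (X 1) \<omega> \<partial>IT.eP 0 (\<lambda>_. undefined))"
      by (simp only:)
    also have "\<dots> = (\<integral>\<^sup>+y. f y * indicator A y \<partial>mc_kernel K x 0 (\<lambda>_. undefined))"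
      using meas[of f 0]
      by (subst IT.nn_integral_eP)
        (auto intro!: nn_integral_cong simp: space_PiM X_def PiE_iff extensional_def split: split_indicator)
    also have "\<dots> = f x * indicator A x"
      by (simp add: mc_kernel_def nn_integral_return)
    finally show ?case by simp
  next
    case (Suc k)
    have sp: "space (IT.C 0 (Suc k) (\<lambda>_. undefined)) = space (PiM {0..<Suc k} ?M)"
      using IT.space_C[OF u, of "Suc k"] by simp
    have se: "sets (IT.C 0 (Suc k) (\<lambda>_. undefined)) = sets (PiM {0..<Suc k} ?M)"
      using IT.sets_C[OF u, of "Suc k"] by simp
    have "(\<integral>\<^sup>+\<omega>. f (\<omega> (Suc k)) * indicator (X (Suc (Suc k))) \<omega> \<partial>IT.C 0 (Suc (Suc k)) (\<lambda>_. undefined)) =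
        (\<integral>\<^sup>+\<omega>. (\<integral>\<^sup>+\<omega>'. f (\<omega>' (Suc k)) * indicator (X (Suc (Suc k))) \<omega>' \<partial>IT.eP (Suc k) \<omega>)
          \<partial>IT.C 0 (Suc k) (\<lambda>_. undefined))"
      using nn_integral_bind[OF meas[of f "Suc k"], of "IT.eP (Suc k)" "IT.C 0 (Suc k) (\<lambda>_. undefined)"]
        IT.measurable_eP[of "Suc k"]
      by (simp add: measurable_cong_sets[OF se refl] del: IT.C.simps(2)
           add: IT.C.simps(2)[of 0 "Suc k"])
    also have "\<dots> = (\<integral>\<^sup>+\<omega>. (\<integral>\<^sup>+y. f y * indicator A y \<partial>measure_pmf (K (\<omega> k))) * indicator (X (Suc k)) \<omega>
          \<partial>IT.C 0 (Suc k) (\<lambda>_. undefined))"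
    proof (rule nn_integral_cong)
      fix \<omega> assume "\<omega> \<in> space (IT.C 0 (Suc k) (\<lambda>_. undefined))"
      then have \<omega>: "\<omega> \<in> space (PiM {0..<Suc k} ?M)" by (simp only: sp)
      then have ext: "\<omega> \<in> extensional {0..<Suc k}" by (simp add: space_PiM PiE_iff)
      have upd: "fun_upd \<omega> (Suc k) y \<in> X (Suc (Suc k)) \<longleftrightarrow> \<omega> \<in> X (Suc k) \<and> y \<in> A" for y
        using ext by (auto simp: X_def PiE_iff extensional_def atLeast0_lessThan_Suc)
      have "(\<integral>\<^sup>+\<omega>'. f (\<omega>' (Suc k)) * indicator (X (Suc (Suc k))) \<omega>' \<partial>IT.eP (Suc k) \<omega>) =
          (\<integral>\<^sup>+y. f y * indicator (X (Suc (Suc k))) (fun_upd \<omega> (Suc k) y) \<partial>measure_pmf (K (\<omega> k)))"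
        by (subst IT.nn_integral_eP[OF \<omega> meas]) (simp add: mc_kernel_def)
      also have "\<dots> = (\<integral>\<^sup>+y. f y * indicator A y \<partial>measure_pmf (K (\<omega> k))) * indicator (X (Suc k)) \<omega>"
        by (subst nn_integral_multc[symmetric])
          (auto intro!: nn_integral_cong simp: upd split: split_indicator)
      finally show "(\<integral>\<^sup>+\<omega>'. f (\<omega>' (Suc k)) * indicator (X (Suc (Suc k))) \<omega>' \<partial>IT.eP (Suc k) \<omega>) = \<dots>" .
    qed
    also have "\<dots> = killed K A f (Suc k) x"
      unfolding killed_Suc' by (rule Suc)
    finally show ?case .
  qed
  have path: "{\<omega>. \<forall>i\<le>n. \<omega> i \<in> A} = IT.PF.emb UNIV {0..<Suc n} (X (Suc n))"
    by (auto simp: prod_emb_def X_def PiE_iff less_Suc_eq_le)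
  have "emeasure (markov_chain K x) {\<omega>. \<forall>i\<le>n. \<omega> i \<in> A} = emeasure (IT.CI {0..<Suc n}) (X (Suc n))"
    unfolding markov_chain_def path by (rule IT.lim) auto
  also have "\<dots> = emeasure (IT.C 0 (Suc n) (\<lambda>_. undefined)) (X (Suc n))"
    by (subst IT.emeasure_CI[of _ "Suc n"]) (auto simp: prod_emb_id X_def PiE_iff)
  also have "\<dots> = killed K A (\<lambda>_. 1) n x"
    using C[where f = "\<lambda>_. 1" and k = n] IT.sets_C[OF u, of "Suc n"] by simp
  finally show ?thesis .
qed

section \<open>Tail sums and first-step analysis\<close>

text \<open>With \<open>N\<close> the first visit to \<open>b\<close>, the \<open>n\<close>-th
  indicator is \<open>1\<close> exactly for \<open>n < N\<close>. Without a visit all indicators are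
  \<open>1\<close> and the sum diverges.\<close>

lemma hitting_time_suminf: "hitting_time b \<omega> = (\<Sum>n. indicator {\<omega>. \<forall>i\<le>n. \<omega> i \<in> - {b}} \<omega>)"
proof (cases "\<exists>n. \<omega> n = b")
  case True
  define N where "N = (LEAST n. \<omega> n = b)"
  have N: "\<omega> N = b" "\<And>i. i < N \<Longrightarrow> \<omega> i \<noteq> b"
    unfolding N_def using True by (auto intro: LeastI_ex dest: not_less_Least)
  have "(\<Sum>n. indicator {\<omega>. \<forall>i\<le>n. \<omega> i \<in> - {b}} \<omega>) =
      (\<Sum>n<N. indicator {\<omega>. \<forall>i\<le>n. \<omega> i \<in> - {b}} \<omega> :: ennreal)"
    using N(1) by (intro suminf_finite) (auto simp: indicator_def not_less)
  also have "\<dots> = (\<Sum>n<N. 1)"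
    using N(2) by (intro sum.cong) (auto simp: indicator_def)
  finally show ?thesis
    using True by (simp add: hitting_time_def N_def)
next
  case False
  have "(\<Sum>n::nat. 1 :: ennreal) = \<infinity>"
    using nn_integral_count_space_nat[of "\<lambda>_. 1"] by simp
  with False show ?thesis
    by (simp add: hitting_time_def)
qed

lemma nn_integral_hitting_time:
  "(\<integral>\<^sup>+\<omega>. hitting_time b \<omega> \<partial>markov_chain K x) = (\<Sum>n. killed K (- {b}) (\<lambda>_. 1) n x)"
proof -
  interpret IT: Ionescu_Tulcea "mc_kernel K x" "\<lambda>_. count_space UNIV"
    by (rule Ionescu_Tulcea_mc_kernel)
  have "{\<omega> \<in> space (PiM UNIV (\<lambda>_. count_space UNIV)). \<forall>i\<in>{..n}. \<omega> i \<in> - {b}}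
      \<in> sets (PiM UNIV (\<lambda>_. count_space UNIV))" for n :: nat
    by (intro sets.sets_Collect_finite_All')
       (auto intro!: measurable_sets_Collect[OF measurable_component_singleton])
  then have "{\<omega>. \<forall>i\<le>n. \<omega> i \<in> - {b}} \<in> sets (markov_chain K x)" for n :: nat
    by (simp add: markov_chain_def space_PiM Ball_def)
  then show ?thesis
    by (simp add: hitting_time_suminf nn_integral_suminf emeasure_markov_chain_stay
        del: Compl_iff)
qed

text \<open>Identifies a guessed bounded solution \<open>h\<close> of the first-step equations with
  the expected hitting time. Iterating the equation \<open>N\<close> times leaves as remainder the
  mean of \<open>h\<close> on survival up to time \<open>N\<close>, which tends to \<open>0\<close>
  because \<open>h\<close> is bounded.\<close>

lemma first_step_analysis:
  fixes K :: "'a \<Rightarrow> 'a pmf" and h :: "'a \<Rightarrow> ennreal"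
  assumes closed: "\<And>y. y \<in> S \<Longrightarrow> set_pmf (K y) \<subseteq> S"
    and "0 \<le> C" and bound: "\<And>y. y \<in> S \<Longrightarrow> h y \<le> ennreal C"
    and b: "h b = 0"
    and step: "\<And>y. y \<in> S \<Longrightarrow> y \<noteq> b \<Longrightarrow> h y = 1 + (\<integral>\<^sup>+z. h z \<partial>measure_pmf (K y))"
    and x: "x \<in> S"
  shows "(\<integral>\<^sup>+\<omega>. hitting_time b \<omega> \<partial>markov_chain K x) = h x"
proof -
  let ?q = "\<lambda>n x. killed K (- {b}) (\<lambda>_. 1) n x" and ?r = "\<lambda>n x. killed K (- {b}) h n x"
  have ind: "h z * indicator (- {b}) z = h z" for z
    using b by (cases "z = b") auto
  have rec: "?r n y = ?q n y + ?r (Suc n) y" if "y \<in> S" for n y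
    using that
  proof (induction n arbitrary: y)
    case 0
    then show ?case
      using step[of y] by (cases "y = b") (simp_all add: ind)
  next
    case (Suc n)
    have "?r (Suc n) y = (\<integral>\<^sup>+z. ?q n z + ?r (Suc n) z \<partial>measure_pmf (K y)) * indicator (- {b}) y"
      unfolding killed.simps(2)[of _ _ _ n y] using Suc closed
      by (intro arg_cong2[where f = "(*)"] nn_integral_cong_AE) (auto simp: AE_measure_pmf_iff)
    then show ?case
      by (simp add: nn_integral_add distrib_right)
  qed
  have partial: "h x = (\<Sum>n<N. ?q n x) + ?r N x" for N
  proof (induction N)
    case (Suc N)
    then show ?case
      using rec[OF x, of N] by (simp only: sum.lessThan_Suc add.assoc)
  qed (simp add: ind)
  have dec: "?q (Suc n) y \<le> ?q n y" for n y
  proof (induction n arbitrary: y)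
    case 0
    have "(\<integral>\<^sup>+z. indicator (- {b}) z \<partial>measure_pmf (K y)) \<le> 1"
      by (simp add: measure_pmf.emeasure_le_1)
    then show ?case
      by (auto simp: mult_right_mono split: split_indicator)
  next
    case (Suc n)
    show ?case
      unfolding killed.simps(2)[of _ _ _ _ y]
      by (intro mult_right_mono nn_integral_mono Suc) auto
  qed
  \<comment> \<open>Survival probabilities decrease, so \<open>N\<close> times the one at time
    \<open>N\<close> is at most the sum of the first \<open>N\<close>, and \<open>partial\<close>
    bounds that sum by \<open>h x\<close>.\<close>
  have Nq: "of_nat N * ?q N x \<le> ennreal C" for N
  proof -
    have "of_nat N * ?q N x = (\<Sum>n<N. ?q N x)" by simp
    also have "\<dots> \<le> (\<Sum>n<N. ?q n x)"
      by (intro sum_mono, rule lift_Suc_antimono_le[of "\<lambda>n. ?q n x"]) (auto intro: dec simp del: killed.simps)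
    also have "\<dots> \<le> h x" by (subst partial[of N]) simp
    finally show ?thesis using bound[OF x] by simp
  qed
  have rq: "?r N x \<le> ennreal C * ?q N x" for N
    using killed_mono[of S h "\<lambda>_. ennreal C * 1" K x "- {b}" N, OF _ closed x]
    unfolding killed_cmult by (simp add: bound)
  have rN: "?r N x \<le> ennreal (C * C / N)" if "N > 0" for N
  proof -
    have "?q N x = of_nat N * ?q N x / of_nat N"
      using that by (metis ennreal_divide_times ennreal_of_nat_neq_top mult.commute mult_divide_eq_ennreal of_nat_eq_0_iff neq0_conv)
    also have "\<dots> \<le> ennreal C / of_nat N"
      by (intro divide_right_mono_ennreal Nq)
    finally have "?r N x \<le> ennreal C * (ennreal C / of_nat N)"
      using rq[of N] by (meson mult_left_mono order_trans zero_le)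
    also have "\<dots> = ennreal (C * C / N)"
      using that \<open>0 \<le> C\<close>
      by (simp add: ennreal_of_nat_eq_real_of_nat divide_ennreal flip: ennreal_mult)
    finally show ?thesis .
  qed
  have "(\<lambda>N. ennreal (C * C / real N)) \<longlonglongrightarrow> ennreal 0"
    by (intro tendsto_ennrealI lim_const_over_n)
  then have lim: "(\<lambda>N. ennreal (C * C / real N)) \<longlonglongrightarrow> 0"
    by simp
  have "(\<lambda>N. ?r N x) \<longlonglongrightarrow> 0"
    by (rule tendsto_sandwich[OF _ _ tendsto_const lim])
      (auto intro!: eventually_sequentiallyI[of 1] rN simp del: killed.simps)
  moreover have "(\<lambda>N. \<Sum>n<N. ?q n x) \<longlonglongrightarrow> (\<Sum>n. ?q n x)"
    by (intro summable_LIMSEQ) auto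
  ultimately have "(\<lambda>N. (\<Sum>n<N. ?q n x) + ?r N x) \<longlonglongrightarrow> (\<Sum>n. ?q n x) + 0"
    by (intro tendsto_add)
  then have "h x = (\<Sum>n. ?q n x)"
    unfolding partial[symmetric] by (simp add: LIMSEQ_const_iff)
  then show ?thesis
    by (simp add: nn_integral_hitting_time)
qed

section \<open>The Ungarian chain of a polygon with an atom that is also a coatom\<close>

text \<open>Index \<open>-1\<close> is the side of length two; \<open>0, \<dots>, m\<close> is the long side from bottom to top.\<close>

locale polygon_lattice =
  fixes L :: "('a, 'b) gorder_scheme" (structure) and c :: "int \<Rightarrow> 'a" and m :: nat
  assumes m_ge_2: "m \<ge> 2"
    and inj_c: "inj_on c {-1..int m}"
    and carrier_L: "carrier L = c ` {-1..int m}"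
    and eq_L: "eq L = (=)"
    and le_L: "i \<in> {-1..int m} \<Longrightarrow> k \<in> {-1..int m} \<Longrightarrow>
      le L (c i) (c k) \<longleftrightarrow> i = k \<or> i = 0 \<or> k = int m \<or> 0 \<le> i \<and> i \<le> k"
begin

lemma c_eq_iff: "i \<in> {-1..int m} \<Longrightarrow> k \<in> {-1..int m} \<Longrightarrow> c i = c k \<longleftrightarrow> i = k"
  using inj_c by (auto simp: inj_on_def)

lemma less_L: "i \<in> {-1..int m} \<Longrightarrow> k \<in> {-1..int m} \<Longrightarrow>
    lless L (c i) (c k) \<longleftrightarrow> i \<noteq> k \<and> (i = 0 \<or> k = int m \<or> 0 \<le> i \<and> i \<le> k)"
  by (auto simp: lless_def eq_L c_eq_iff le_L)

lemma antisym_L: "x \<in> carrier L \<Longrightarrow> y \<in> carrier L \<Longrightarrow> le L x y \<Longrightarrow> le L y x \<Longrightarrow> x = y"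
  using m_ge_2 by (auto simp: carrier_L le_L)

text \<open>\<open>bottom\<close> is a Hilbert choice, so the witness must be shown unique, which
  antisymmetry gives. The same pattern serves \<open>top_L\<close> and
  \<open>inf_eqI\<close>.\<close>

lemma bottom_L: "bottom L = c 0"
  unfolding bottom_def
proof (rule some_equality)
  show "least L (c 0) (carrier L)"
    using m_ge_2 by (auto simp: least_def carrier_L le_L)
  then show "x = c 0" if "least L x (carrier L)" for x
    using that antisym_L by (auto simp: least_def)
qed

lemma top_L: "Order.top L = c (int m)"
  unfolding Order.top_def
proof (rule some_equality)
  show "greatest L (c (int m)) (carrier L)"
    using m_ge_2 by (auto simp: greatest_def carrier_L le_L)
  then show "x = c (int m)" if "greatest L x (carrier L)" for x
    using that antisym_L by (auto simp: greatest_def)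
qed

lemma inf_eqI:
  assumes "A \<subseteq> carrier L" "x \<in> carrier L" "\<And>a. a \<in> A \<Longrightarrow> le L x a"
    and "\<And>y. y \<in> carrier L \<Longrightarrow> (\<And>a. a \<in> A \<Longrightarrow> le L y a) \<Longrightarrow> le L y x"
  shows "Lattice.inf L A = x"
  unfolding Lattice.inf_def
proof (rule some_equality)
  show gr: "greatest L x (Lower L A)"
    using assms(1-3) by (auto simp: greatest_def Lower_def subset_iff intro!: assms(4))
  show "y = x" if "greatest L y (Lower L A)" for y
    using that gr by (intro antisym_L) (auto simp: greatest_def Lower_def)
qed

lemma inf_above:
  assumes "x \<in> carrier L" "y \<in> carrier L" "le L y x"
  shows "Lattice.inf L {x, y} = y"
  using assms by (intro inf_eqI) (auto simp: carrier_L le_L)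

lemma inf_singleton: "x \<in> carrier L \<Longrightarrow> Lattice.inf L {x} = x"
  using inf_above[of x x] by (auto simp: carrier_L le_L)

text \<open>Only \<open>c (-1)\<close> and \<open>c 0\<close> lie below \<open>c (-1)\<close>, and
  \<open>c (-1)\<close> is not below \<open>c (int m - 1)\<close>. Selecting both coatoms therefore
  drops from the top straight to the bottom.\<close>

lemma inf_coatoms: "Lattice.inf L {c (int m), c (int m - 1), c (-1)} = c 0"
proof (rule inf_eqI)
  fix y assume "y \<in> carrier L"
    and y: "\<And>a. a \<in> {c (int m), c (int m - 1), c (-1)} \<Longrightarrow> le L y a"
  then obtain k where k: "k \<in> {-1..int m}" "y = c k" by (auto simp: carrier_L)
  then show "le L y (c 0)"
    using y[of "c (int m - 1)"] y[of "c (-1)"] le_L[OF k(1), of "int m - 1"] le_L[OF k(1), of "-1"]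
      le_L[OF k(1), of 0] m_ge_2 by auto
qed (use m_ge_2 in \<open>auto simp: carrier_L le_L\<close>)

lemma covers_c_iff:
  assumes "i \<in> {-1..int m}" "k \<in> {-1..int m}"
  shows "covers L (c k) (c i) \<longleftrightarrow> 1 \<le> k \<and> i = k - 1 \<or> k = -1 \<and> i = 0 \<or> k = int m \<and> i = -1"
    (is "?L = ?R")
proof
  assume ?L
  then have less: "lless L (c i) (c k)"
    and between: "\<And>j. j \<in> {-1..int m} \<Longrightarrow> lless L (c i) (c j) \<Longrightarrow> \<not> lless L (c j) (c k)"
    by (auto simp: covers_def carrier_L)
  \<comment> \<open>On the long side \<open>c (i + 1)\<close> lies strictly between
    \<open>c i\<close> and \<open>c k\<close> unless \<open>k = i + 1\<close>.\<close>
  from between[of "i + 1"] between[of 1] less show ?R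
    using assms m_ge_2 by (auto simp: less_L)
next
  assume ?R
  then show ?L
    using assms m_ge_2 by (auto simp: covers_def carrier_L less_L)
qed

lemma covers_set:
  assumes "k \<in> {-1..int m}"
  shows "{y. covers L (c k) y} =
    c ` {i \<in> {-1..int m}. 1 \<le> k \<and> i = k - 1 \<or> k = -1 \<and> i = 0 \<or> k = int m \<and> i = -1}"
  (is "_ = c ` ?I")
proof (intro Set.set_eqI iffI)
  fix y assume "y \<in> {y. covers L (c k) y}"
  moreover from this obtain i where "i \<in> {-1..int m}" "y = c i"
    by (auto simp: covers_def carrier_L)
  ultimately show "y \<in> c ` ?I"
    using covers_c_iff[OF _ assms] by blast
next
  fix y assume "y \<in> c ` ?I"
  then show "y \<in> {y. covers L (c k) y}"
    using covers_c_iff[OF _ assms] by blast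
qed

lemma covers_set_0: "{y. covers L (c 0) y} = {}"
  by (subst covers_set) (use m_ge_2 in auto)

lemma covers_set_atom: "{y. covers L (c (-1)) y} = {c 0}"
  by (subst covers_set) (use m_ge_2 in auto)

lemma covers_set_chain: "1 \<le> k \<Longrightarrow> k < int m \<Longrightarrow> {y. covers L (c k) y} = {c (k - 1)}"
  by (subst covers_set) auto

lemma covers_set_top: "{y. covers L (c (int m)) y} = {c (int m - 1), c (-1)}"
  by (subst covers_set) (use m_ge_2 in auto)

end

section \<open>Random subsets, one element at a time\<close>

lemma random_subset_empty: "random_subset p {} = return_pmf {}"
  by (simp add: random_subset_def)

lemma random_subset_insert:
  assumes "finite A" "x \<notin> A"
  shows "random_subset p (insert x A) =
    map_pmf (\<lambda>(b, T). if b then insert x T else T) (pair_pmf (bernoulli_pmf p) (random_subset p A))"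
  unfolding random_subset_def Pi_pmf_insert[OF assms] pair_map_pmf2 pmf.map_comp
  using assms by (intro map_pmf_cong refl) (auto split: if_splits)

text \<open>Conditions on whether \<open>x\<close> is selected; used once per covered element, it
  expands the kernel into its outcomes.\<close>

lemma nn_integral_random_subset_insert:
  assumes "finite A" "x \<notin> A" "0 \<le> p" "p \<le> 1"
  shows "(\<integral>\<^sup>+T. f T \<partial>random_subset p (insert x A)) =
    ennreal p * (\<integral>\<^sup>+T. f (insert x T) \<partial>random_subset p A) + ennreal (1 - p) * (\<integral>\<^sup>+T. f T \<partial>random_subset p A)"
  using assms by (simp add: random_subset_insert nn_integral_pair_pmf' mult.commute)

section \<open>Expected absorption time of the polygon\<close>

context polygon_lattice
begin

text \<open>Provides the closed set for \<open>first_step_analysis\<close>. Meets are Hilbert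
  choices, so every meet that can occur is computed.\<close>

lemma set_ungarian_kernel:
  assumes "x \<in> carrier L"
  shows "set_pmf (ungarian_kernel L p x) \<subseteq> carrier L"
proof -
  obtain k where k: "k \<in> {-1..int m}" "x = c k" using assms by (auto simp: carrier_L)
  have sub: "set_pmf (random_subset p {y. covers L x y}) \<subseteq> Pow {y. covers L x y}"
    by (auto simp: random_subset_def)
  have "Lattice.inf L (insert x T) \<in> carrier L" if "T \<subseteq> {y. covers L x y}" for T
  proof -
    consider "k = 0" | "k = -1" | "1 \<le> k" "k < int m" | "k = int m" using k by fastforce
    then show ?thesis
    proof cases
      case 1
      then show ?thesis using that k m_ge_2 by (simp add: covers_set_0 inf_singleton carrier_L)
    next
      case 2
      then have "T = {} \<or> T = {c 0}" using that k by (auto simp: covers_set_atom)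
      with 2 k m_ge_2 show ?thesis by (auto simp: inf_singleton inf_above carrier_L le_L)
    next
      case 3
      then have "T = {} \<or> T = {c (k - 1)}" using that k by (auto simp: covers_set_chain)
      with 3 k m_ge_2 show ?thesis by (auto simp: inf_singleton inf_above carrier_L le_L)
    next
      case 4
      then have "T = {} \<or> T = {c (int m - 1)} \<or> T = {c (-1)} \<or> T = {c (int m - 1), c (-1)}"
        using that k by (auto simp: covers_set_top)
      with 4 k m_ge_2 show ?thesis
        by (auto simp: inf_singleton inf_above inf_coatoms carrier_L le_L)
    qed
  qed
  with sub show ?thesis by (auto simp: ungarian_kernel_def)
qed

theorem ungarian_expectation:
  assumes p: "0 < p" "p \<le> 1"
  shows "ungarian_expectation L p = ennreal ((1 + real m * (1 - p)) / (2 * p - p\<^sup>2))"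
proof -
  define V where "V = (1 + real m * (1 - p)) / (2 * p - p\<^sup>2)"
  \<comment> \<open>The guessed expected times: each element covering a single other one adds a
    geometric waiting time of mean \<open>1/p\<close>, and \<open>V\<close> solves the equation at
    the top.\<close>
  define E where "E k = (if k = int m then V else if k = -1 then 1 / p else real_of_int k / p)" for k
  define h where "h y = ennreal (E (the_inv_into {-1..int m} c y))" for y
  have h: "h (c k) = ennreal (E k)" if "k \<in> {-1..int m}" for k
    using that inj_c by (simp add: h_def the_inv_into_f_f)
  have pos: "2 * p - p\<^sup>2 > 0"
    using p by (simp add: power2_eq_square)
  have V: "V \<ge> 0"
    using p pos by (simp add: V_def)
  have E: "E k \<ge> 0" if "k \<in> {-1..int m}" for k
    using that p V by (auto simp: E_def)
  have h0: "h (c 0) = 0"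
    using h[of 0] m_ge_2 by (simp add: E_def)
  \<comment> \<open>Elements with one lower cover: \<open>E k = 1 + p * E j + (1 - p) * E k\<close>
    amounts to \<open>E k = E j + 1 / p\<close>.\<close>
  have step1: "h (c k) = 1 + (\<integral>\<^sup>+z. h z \<partial>measure_pmf (ungarian_kernel L p (c k)))"
    if k: "k \<in> {-1..int m}" and j: "j \<in> {-1..int m}" "le L (c j) (c k)"
      and cov: "{y. covers L (c k) y} = {c j}" and e: "E k = E j + 1 / p"
    for k j
  proof -
    have "(\<integral>\<^sup>+z. h z \<partial>measure_pmf (ungarian_kernel L p (c k))) =
        ennreal p * h (c j) + ennreal (1 - p) * h (c k)"
      using p k j by (simp add: ungarian_kernel_def cov nn_integral_random_subset_insert
        random_subset_empty nn_integral_return inf_singleton inf_above carrier_L)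
    also have "\<dots> = ennreal (p * E j + (1 - p) * E k)"
      using p E[OF k] E[OF j(1)] by (simp add: h[OF k] h[OF j(1)] ennreal_mult ennreal_plus)
    also have "1 + \<dots> = ennreal (1 + (p * E j + (1 - p) * E k))"
      using p E[OF k] E[OF j(1)] by (simp add: ennreal_plus)
    also have "1 + (p * E j + (1 - p) * E k) = E k"
      using p e by (simp add: field_simps)
    finally show ?thesis using h[OF k] by simp
  qed
  have step: "h y = 1 + (\<integral>\<^sup>+z. h z \<partial>measure_pmf (ungarian_kernel L p y))"
    if y: "y \<in> carrier L" "y \<noteq> c 0" for y
  proof -
    from y(1) obtain k where k: "k \<in> {-1..int m}" "y = c k" by (auto simp: carrier_L)
    with y(2) have "k \<noteq> 0" by blast
    with k(1) consider "k = -1" | "1 \<le> k" "k < int m" | "k = int m"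
      unfolding atLeastAtMost_iff by linarith
    then show ?thesis
    proof cases
      case 1
      then show ?thesis
        using step1[of "-1" 0] k m_ge_2 by (simp add: covers_set_atom le_L E_def)
    next
      case 2
      then show ?thesis
        using step1[of k "k - 1"] k m_ge_2 p
        by (simp add: covers_set_chain le_L E_def field_simps)
    next
      case 3
      have "c (int m - 1) \<noteq> c (-1)"
        using m_ge_2 by (subst c_eq_iff) auto
      \<comment> \<open>The four outcomes at the top: both coatoms, only the one on the long side,
        only the atom \<open>c (-1)\<close>, or none.\<close>
      then have "(\<integral>\<^sup>+z. h z \<partial>measure_pmf (ungarian_kernel L p y)) =
          ennreal p * (ennreal p * h (c 0) + ennreal (1 - p) * h (c (int m - 1))) +
          ennreal (1 - p) * (ennreal p * h (c (-1)) + ennreal (1 - p) * h (c (int m)))"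
        using p k 3 m_ge_2
        by (simp add: ungarian_kernel_def covers_set_top nn_integral_random_subset_insert
          random_subset_empty nn_integral_return inf_singleton inf_above inf_coatoms carrier_L le_L)
      also have "\<dots> = ennreal (p * (p * E 0 + (1 - p) * E (int m - 1)) + (1 - p) * (p * E (- 1) + (1 - p) * E (int m)))"
        using p E[of "int m - 1"] E[of 0] E[of "-1"] E[of "int m"] m_ge_2
        by (simp add: h ennreal_mult ennreal_plus)
      also have "p * (p * E 0 + (1 - p) * E (int m - 1)) + (1 - p) * (p * E (- 1) + (1 - p) * E (int m)) =
          real m * (1 - p) + (1 - p)\<^sup>2 * V"
        using m_ge_2 p by (simp add: E_def field_simps power2_eq_square)
      also have "1 + ennreal \<dots> = ennreal (1 + (real m * (1 - p) + (1 - p)\<^sup>2 * V))"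
        using p V by (simp add: ennreal_plus)
      \<comment> \<open>Since \<open>1 - (1 - p)^2 = 2p - p^2\<close>, this is the defining equation
        of \<open>V\<close>.\<close>
      also have "1 + (real m * (1 - p) + (1 - p)\<^sup>2 * V) = V"
      proof -
        have "V * (2 * p - p\<^sup>2) = 1 + real m * (1 - p)"
          using pos by (simp add: V_def)
        then show ?thesis by (simp add: power2_eq_square algebra_simps)
      qed
      finally show ?thesis
        using h[of "int m"] k 3 by (simp add: E_def)
    qed
  qed
  have bound: "h y \<le> ennreal (V + real m / p)" if y: "y \<in> carrier L" for y
  proof -
    from y obtain k where k: "k \<in> {-1..int m}" "y = c k" by (auto simp: carrier_L)
    have "E k \<le> V + real m / p"
      using k V p m_ge_2 by (auto simp: E_def intro!: add_increasing divide_right_mono)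
    with k h show ?thesis by (simp add: ennreal_leI)
  qed
  have "ungarian_expectation L p = h (c (int m))"
    unfolding ungarian_expectation_def bottom_L top_L
    by (rule first_step_analysis[where S = "carrier L" and C = "V + real m / p"])
      (use set_ungarian_kernel bound step h0 V p m_ge_2 in \<open>auto simp: carrier_L\<close>)
  with h[of "int m"] show ?thesis by (simp add: E_def V_def)
qed

end

section \<open>Reduced and sortable words in dihedral groups\<close>

lemma word_val_simps [simp]:
  "word_val G [] = \<one>\<^bsub>G\<^esub>"
  "word_val G (x # u) = x \<otimes>\<^bsub>G\<^esub> word_val G u"
  by (simp_all add: word_val_def)

section \<open>Alternating words and their walks on the line\<close>

primrec alternating :: "nat \<Rightarrow> 'a \<Rightarrow> 'a \<Rightarrow> 'a list" where
  "alternating 0 x y = []"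
| "alternating (Suc n) x y = x # alternating n y x"

lemma length_alternating [simp]: "length (alternating n x y) = n"
  by (induction n arbitrary: x y) auto

lemma set_alternating: "set (alternating n x y) \<subseteq> {x, y}"
  by (induction n arbitrary: x y) fastforce+

lemma take_alternating: "k \<le> n \<Longrightarrow> take k (alternating n x y) = alternating k x y"
proof (induction n arbitrary: k x y)
  case (Suc n)
  then show ?case by (cases k) auto
qed simp

lemma map_alternating:
  "map (\<lambda>i. [a, b] ! (i mod 2)) [n..<n + k] = (if even n then alternating k a b else alternating k b a)"
proof (induction k arbitrary: n)
  case (Suc k)
  have upt: "[n..<n + Suc k] = n # [Suc n..<Suc n + k]"
    by (simp add: upt_conv_Cons del: upt_Suc)
  have "[a, b] ! (n mod 2) = (if even n then a else b)"
    by (cases "even n") (auto simp: even_iff_mod_2_eq_zero odd_iff_mod_2_eq_one)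
  then show ?case
    using Suc[of "Suc n"] unfolding upt by simp
qed simp

text \<open>The Cayley graph of the dihedral group is a cycle of length \<open>2m\<close> with edges labelled alternately
  by the two reflections. Its universal cover is the line of integers: the edge from \<open>k\<close> to \<open>k + 1\<close>
  is labelled \<open>a\<close> if \<open>k\<close> is even and \<open>b\<close> otherwise. A word is read as a walk on this line.\<close>

primrec walk :: "'a \<Rightarrow> int \<Rightarrow> 'a list \<Rightarrow> int" where
  "walk a k [] = k"
| "walk a k (x # u) = walk a (if (x = a) = even k then k + 1 else k - 1) u"

lemma walk_append: "walk a k (u @ v) = walk a (walk a k u) v"
  by (induction u arbitrary: k) auto

text \<open>As \<open>2 * n\<close> is even, congruent positions have the same parity and see the
  same edge labels.\<close>

lemma walk_cong_mod:
  "[k = l] (mod 2 * n) \<Longrightarrow> [walk a k u = walk a l u] (mod 2 * n)"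
proof (induction u arbitrary: k l)
  case (Cons x u)
  have "even k = even l"
    using Cons.prems by (meson cong_dvd_iff cong_dvd_modulus dvd_triv_left)
  then show ?case
    using Cons by (auto intro!: Cons.IH cong_add cong_diff)
qed simp

lemma walk_double: "walk a k [x, x] = k"
  by auto

lemma walk_pairs:
  "x \<noteq> y \<Longrightarrow> a \<in> {x, y} \<Longrightarrow> walk a k (concat (replicate n [x, y])) =
    (if (x = a) = even k then k + 2 * int n else k - 2 * int n)"
  by (induction n arbitrary: k) auto

text \<open>A relator \<open>xx\<close> walks forth and back, and \<open>(xy)^m\<close> walks once
  around the cycle. This invariant later separates the group elements.\<close>

lemma walk_coxeter_cong:
  assumes "coxeter_cong {a, b} (\<lambda>x y. if x = y then 1 else m) u v"
  shows "[walk a k u = walk a k v] (mod 2 * int m)"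
  using assms
proof (induction arbitrary: k)
  case (cong_relation s t u v)
  let ?r = "concat (replicate (if s = t then 1 else m) [s, t])"
  have "[walk a l ?r = l] (mod 2 * int m)" for l
  proof (cases "s = t")
    case True
    then show ?thesis using walk_double[of a l s] by simp
  next
    case False
    then show ?thesis
      using cong_relation walk_pairs[of s t a l m]
      by (auto simp: cong_iff_dvd_diff)
  qed
  then show ?case
    by (simp add: walk_append walk_cong_mod)
qed (auto intro: cong_sym cong_trans)

lemma abs_walk_le: "\<bar>walk a k u - k\<bar> \<le> int (length u)"
proof (induction u arbitrary: k)
  case (Cons x u)
  from Cons[of "k + 1"] Cons[of "k - 1"] show ?case by auto
qed simp

lemma walk_alternating:
  "x \<noteq> y \<Longrightarrow> a \<in> {x, y} \<Longrightarrow>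
    walk a k (alternating n x y) = (if (x = a) = even k then k + int n else k - int n)"
  by (induction n arbitrary: k x y) auto

text \<open>A walk that never turns back has each letter forced by the parity of its position. This
  is the uniqueness half of the description of reduced words.\<close>

lemma walk_extremal:
  assumes "a \<noteq> b"
  shows "set u \<subseteq> {a, b} \<Longrightarrow> walk a k u = k + int (length u) \<Longrightarrow>
      u = (if even k then alternating (length u) a b else alternating (length u) b a)"
    and "set u \<subseteq> {a, b} \<Longrightarrow> walk a k u = k - int (length u) \<Longrightarrow>
      u = (if even k then alternating (length u) b a else alternating (length u) a b)"
proof (induction u arbitrary: k)
  case (Cons x u)
  {
    case 1
    \<comment> \<open>A first step in the wrong direction could not be made up by the remaining
      letters.\<close>
    with abs_walk_le[of a "k + 1" u] abs_walk_le[of a "k - 1" u]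
    have "(x = a) = even k" by (auto split: if_splits)
    with 1 Cons.IH(1)[of "k + 1"] \<open>a \<noteq> b\<close> show ?case by auto
  next
    case 2
    with abs_walk_le[of a "k + 1" u] abs_walk_le[of a "k - 1" u]
    have "(x = a) \<noteq> even k" by (auto split: if_splits)
    with 2 Cons.IH(2)[of "k - 1"] \<open>a \<noteq> b\<close> show ?case by auto
  }
qed auto

text \<open>At the first place where \<open>qs\<close> skips a number, its entry exceeds that of the
  interval. Sorting words are recognized this way.\<close>

lemma lexord_upt:
  assumes "sorted_wrt (<) qs" "\<And>q. q \<in> set qs \<Longrightarrow> n \<le> q"
  shows "[n..<n + length qs] = qs \<or> ([n..<n + length qs], qs) \<in> lexord {(i, j). i < j}"
  using assms
proof (induction qs arbitrary: n)
  case (Cons q qs)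
  have upt: "[n..<n + length (q # qs)] = n # [Suc n..<Suc n + length qs]"
    by (simp add: upt_conv_Cons del: upt_Suc)
  show ?case
  proof (cases "q = n")
    case True
    with Cons.IH[of "Suc n"] Cons.prems show ?thesis
      unfolding upt by (auto simp: Suc_le_eq)
  next
    case False
    with Cons.prems(2)[of q] show ?thesis
      unfolding upt by auto
  qed
qed simp

section \<open>Elements and reduced words of the dihedral group\<close>

locale dihedral = group G for G (structure) +
  fixes a b :: 'a and m :: nat
  assumes m_ge_2: "m \<ge> 2"
    and system: "dihedral_coxeter_system m G a b"
begin

lemma a_neq_b: "a \<noteq> b"
  using system by (simp add: dihedral_coxeter_system_def)

lemma ab_carrier [simp]: "a \<in> carrier G" "b \<in> carrier G"
  using system by (simp_all add: dihedral_coxeter_system_def coxeter_system_def)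

lemma word_val_eq_iff: "u \<in> lists {a, b} \<Longrightarrow> v \<in> lists {a, b} \<Longrightarrow>
    word_val G u = word_val G v \<longleftrightarrow> coxeter_cong {a, b} (\<lambda>x y. if x = y then 1 else m) u v"
  using system by (simp add: dihedral_coxeter_system_def coxeter_system_def)

lemma square_eq_one: "x \<in> {a, b} \<Longrightarrow> x \<otimes> x = \<one>"
  using word_val_eq_iff[of "[x, x]" "[]"]
    coxeter_cong.cong_relation[of x "{a, b}" x "\<lambda>x y. if x = y then 1 else m" "[]" "[]"] by auto

text \<open>The covering map from the line to the Cayley graph. As \<open>div\<close> rounds down,
  \<open>elt (-1)\<close> is \<open>(ab)^(-1) a\<close>, which is \<open>b\<close>.\<close>

definition elt :: "int \<Rightarrow> 'a" where
  "elt k = (a \<otimes> b) [^] (k div 2) \<otimes> (if even k then \<one> else a)"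

lemma elt_carrier [simp]: "elt k \<in> carrier G"
  by (simp add: elt_def)

lemma elt_0 [simp]: "elt 0 = \<one>"
  by (simp add: elt_def)

text \<open>Right multiplication by a reflection follows the edge with that label; both parities
  reduce to \<open>aa = bb = 1\<close>.\<close>

lemma elt_step:
  assumes "x \<in> {a, b}"
  shows "elt k \<otimes> x = elt (if (x = a) = even k then k + 1 else k - 1)"
proof (cases "even k")
  case True
  then obtain j where k: "k = 2 * j" by blast
  have div: "(2 * j - 1) div 2 = j - 1" by simp
  have "(a \<otimes> b) [^] j \<otimes> b = (a \<otimes> b) [^] (j - 1) \<otimes> a"
  proof -
    have "(a \<otimes> b) [^] j = (a \<otimes> b) [^] (j - 1) \<otimes> (a \<otimes> b)"
      using int_pow_mult[of "a \<otimes> b" "j - 1" 1] by simp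
    then show ?thesis
      using square_eq_one[of b] by (simp add: m_assoc)
  qed
  then show ?thesis
    using assms a_neq_b by (auto simp: elt_def k div)
next
  case False
  then obtain j where k: "k = 2 * j + 1" by (rule oddE)
  have "(a \<otimes> b) [^] (1 + j) = (a \<otimes> b) [^] j \<otimes> (a \<otimes> b)"
    using int_pow_mult[of "a \<otimes> b" j 1] by (simp add: add.commute)
  moreover have "(2 * j + 2) div 2 = 1 + j" by simp
  ultimately show ?thesis
    using assms a_neq_b square_eq_one[of a] by (auto simp: elt_def k m_assoc)
qed

lemma word_val_carrier: "u \<in> lists {a, b} \<Longrightarrow> word_val G u \<in> carrier G"
  by (induction u) auto

lemma elt_word_val: "u \<in> lists {a, b} \<Longrightarrow> elt k \<otimes> word_val G u = elt (walk a k u)"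
proof (induction u arbitrary: k)
  case (Cons x u)
  then have "word_val G u \<in> carrier G"
    by (auto intro: word_val_carrier)
  with Cons elt_step[of x k] a_neq_b show ?case
    by (auto simp flip: m_assoc)
qed simp

lemma word_val_eq_elt: "u \<in> lists {a, b} \<Longrightarrow> word_val G u = elt (walk a 0 u)"
  using elt_word_val[of u 0] by (simp add: word_val_carrier)

text \<open>The straight walk from \<open>0\<close> to \<open>k\<close>, whose sign selects the
  first letter. The two reduced words of the longest element are \<open>word m\<close> and
  \<open>word (-m)\<close>.\<close>

definition word :: "int \<Rightarrow> 'a list" where
  "word k = (if k \<ge> 0 then alternating (nat k) a b else alternating (nat (- k)) b a)"

lemma length_word [simp]: "length (word k) = nat \<bar>k\<bar>"
  by (simp add: word_def)

lemma word_lists [simp]: "word k \<in> lists {a, b}"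
  using set_alternating[of _ a b] set_alternating[of _ b a] by (auto simp: word_def)

lemma walk_word [simp]: "walk a 0 (word k) = k"
  using a_neq_b by (simp add: word_def walk_alternating)

lemma word_val_word [simp]: "word_val G (word k) = elt k"
  by (simp add: word_val_eq_elt)

lemma take_word: "n \<le> nat \<bar>k\<bar> \<Longrightarrow> take n (word k) = word (sgn k * int n)"
  by (cases "k = 0") (auto simp: word_def take_alternating sgn_if)

text \<open>Forwards, the endpoint of a walk modulo \<open>2m\<close> is invariant; backwards,
  \<open>(ab)^m = 1\<close> makes \<open>elt\<close> periodic.\<close>

lemma elt_eq_iff: "elt i = elt j \<longleftrightarrow> [i = j] (mod 2 * int m)"
proof
  assume "elt i = elt j"
  then have "word_val G (word i) = word_val G (word j)" by simp
  then have "coxeter_cong {a, b} (\<lambda>x y. if x = y then 1 else m) (word i) (word j)"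
    by (simp only: word_val_eq_iff[OF word_lists word_lists])
  then have "[walk a 0 (word i) = walk a 0 (word j)] (mod 2 * int m)"
    by (rule walk_coxeter_cong)
  then show "[i = j] (mod 2 * int m)" by simp
next
  have "coxeter_cong {a, b} (\<lambda>x y. if x = y then 1 else m) (concat (replicate m [a, b])) []"
    using coxeter_cong.cong_relation[of a "{a, b}" b "\<lambda>x y. if x = y then 1 else m" "[]" "[]"]
      a_neq_b by simp
  moreover have lists: "concat (replicate n [a, b]) \<in> lists {a, b}" for n
    by (induction n) auto
  ultimately have "word_val G (concat (replicate m [a, b])) = \<one>"
    using word_val_eq_iff[of _ "[]"] by simp
  then have "elt (2 * int m) = \<one>"
    using a_neq_b word_val_eq_elt[OF lists, of m] by (simp add: walk_pairs)
  then have order: "(a \<otimes> b) [^] int m = \<one>"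
    by (simp add: elt_def)
  assume "[i = j] (mod 2 * int m)"
  then obtain q where "j = i + 2 * int m * q"
    by (auto simp: cong_iff_lin)
  then have "j div 2 = i div 2 + int m * q" "even j = even i"
    by (auto simp: mult.assoc)
  moreover have "(a \<otimes> b) [^] (i div 2 + int m * q) = (a \<otimes> b) [^] (i div 2)"
    using int_pow_pow[of "a \<otimes> b" "int m" q] order by (simp add: int_pow_mult)
  ultimately show "elt i = elt j"
    by (simp add: elt_def)
qed

lemma elt_eq_imp:
  assumes "elt i = elt j" "\<bar>i\<bar> \<le> int m" "\<bar>j\<bar> \<le> int m"
  shows "i = j \<or> i = - j \<and> \<bar>i\<bar> = int m"
proof -
  obtain q where q: "j = i + 2 * int m * q"
    using assms(1) by (auto simp: elt_eq_iff cong_iff_lin)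
  have "int m * \<bar>q\<bar> \<le> int m * 1"
    using q assms(2,3) by (simp flip: abs_mult)
  then have "\<bar>q\<bar> \<le> 1"
    using m_ge_2 by simp
  then consider "q = 0" | "q = 1" | "q = -1" by linarith
  then show ?thesis
    using q assms(2,3) by cases auto
qed

text \<open>A shortest word walks straight to its endpoint \<open>j\<close>, and if
  \<open>|j| > m\<close> a shift by \<open>2m\<close> towards \<open>0\<close> gives a shorter one.
  Conversely, straight walks of length at most \<open>m\<close> are shortest because
  \<open>elt\<close> identifies only the two ends of \<open>[-m, m]\<close>.\<close>

lemma reduced_word_iff:
  "reduced_word G {a, b} w u \<longleftrightarrow> (\<exists>j. \<bar>j\<bar> \<le> int m \<and> u = word j \<and> w = elt j)"
proof
  assume red: "reduced_word G {a, b} w u"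
  define j where "j = walk a 0 u"
  have u: "u \<in> lists {a, b}"
    and min: "\<And>v. v \<in> lists {a, b} \<Longrightarrow> word_val G v = w \<Longrightarrow> length u \<le> length v"
    using red by (auto simp: reduced_word_def)
  have w: "w = elt j"
    using red word_val_eq_elt[OF u] by (simp add: reduced_word_def j_def)
  have len: "int (length u) = \<bar>j\<bar>"
    using min[of "word j"] abs_walk_le[of a 0 u] w by (simp add: j_def)
  have "set u \<subseteq> {a, b}" using u by auto
  note extremal = walk_extremal[OF a_neq_b this, of 0, folded j_def]
  have "u = word j"
  proof (cases "j \<ge> 0")
    case True
    with len have "j = int (length u)" by simp
    with extremal(1) show ?thesis by (simp add: word_def)
  next
    case False
    with len have "j = - int (length u)" by simp
    with extremal(2) False show ?thesis by (simp add: word_def)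
  qed
  moreover have "\<bar>j\<bar> \<le> int m"
  proof (rule ccontr)
    assume big: "\<not> \<bar>j\<bar> \<le> int m"
    define i where "i = j - 2 * int m * sgn j"
    have "elt i = w"
      unfolding w elt_eq_iff i_def by (simp add: cong_iff_dvd_diff)
    then have "length u \<le> nat \<bar>i\<bar>"
      using min[of "word i"] by simp
    with big len m_ge_2 show False
      by (auto simp: i_def sgn_if split: if_splits)
  qed
  ultimately show "\<exists>j. \<bar>j\<bar> \<le> int m \<and> u = word j \<and> w = elt j"
    using w by blast
next
  assume "\<exists>j. \<bar>j\<bar> \<le> int m \<and> u = word j \<and> w = elt j"
  then obtain j where j: "\<bar>j\<bar> \<le> int m" "u = word j" "w = elt j" by blast
  have "length u \<le> length v" if v: "v \<in> lists {a, b}" "word_val G v = w" for v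
  proof (rule ccontr)
    assume "\<not> length u \<le> length v"
    then have "\<bar>walk a 0 v\<bar> < \<bar>j\<bar>"
      using abs_walk_le[of a 0 v] j(2) by simp
    moreover have "elt (walk a 0 v) = elt j"
      using v j(3) by (simp add: word_val_eq_elt)
    ultimately show False
      using elt_eq_imp[of "walk a 0 v" j] j(1) by auto
  qed
  with j show "reduced_word G {a, b} w u"
    by (simp add: reduced_word_def)
qed

text \<open>A prefix of a straight walk is a straight walk in the same direction. Representatives
  are quantified because the longest element has two.\<close>

lemma right_weak_le_iff: "right_weak_le G {a, b} u v \<longleftrightarrow>
    (\<exists>i j. u = elt i \<and> v = elt j \<and> \<bar>j\<bar> \<le> int m \<and> (0 \<le> i \<and> i \<le> j \<or> j \<le> i \<and> i \<le> 0))"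
proof
  assume "right_weak_le G {a, b} u v"
  then obtain p q where pq: "reduced_word G {a, b} v (p @ q)" "reduced_word G {a, b} u p"
    by (auto simp: right_weak_le_def)
  from pq(1) obtain j where j: "\<bar>j\<bar> \<le> int m" "p @ q = word j" "v = elt j"
    by (auto simp: reduced_word_iff)
  have len: "length p \<le> nat \<bar>j\<bar>"
    using arg_cong[OF j(2), of length] by simp
  have "p = take (length p) (word j)"
    by (simp flip: j(2))
  then have "p = word (sgn j * int (length p))"
    using take_word[OF len] by simp
  moreover have "u = word_val G p"
    using pq(2) by (simp add: reduced_word_def)
  ultimately have "u = elt (sgn j * int (length p))"
    using word_val_word by metis
  then show "\<exists>i j. u = elt i \<and> v = elt j \<and> \<bar>j\<bar> \<le> int m \<and> (0 \<le> i \<and> i \<le> j \<or> j \<le> i \<and> i \<le> 0)"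
    using j len by (intro exI[of _ "sgn j * int (length p)"] exI[of _ j]) (auto simp: sgn_if)
next
  assume "\<exists>i j. u = elt i \<and> v = elt j \<and> \<bar>j\<bar> \<le> int m \<and> (0 \<le> i \<and> i \<le> j \<or> j \<le> i \<and> i \<le> 0)"
  then obtain i j where ij: "u = elt i" "v = elt j" "\<bar>j\<bar> \<le> int m" "0 \<le> i \<and> i \<le> j \<or> j \<le> i \<and> i \<le> 0"
    by blast
  then have "sgn j * int (nat \<bar>i\<bar>) = i" "nat \<bar>i\<bar> \<le> nat \<bar>j\<bar>"
    by (auto simp: sgn_if)
  then have "word i @ drop (nat \<bar>i\<bar>) (word j) = word j"
    using take_word[of "nat \<bar>i\<bar>" j] by (metis append_take_drop_id)
  moreover have "reduced_word G {a, b} v (word j)" "reduced_word G {a, b} u (word i)"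
    unfolding reduced_word_iff using ij by (auto intro: exI[of _ j] exI[of _ i])
  ultimately show "right_weak_le G {a, b} u v"
    unfolding right_weak_le_def by metis
qed

section \<open>Sorting words and sortable elements\<close>

lemma reduced_subword_iff: "reduced_subword G {a, b} [a, b] w ps \<longleftrightarrow>
    sorted_wrt (<) ps \<and> (\<exists>j. \<bar>j\<bar> \<le> int m \<and> map (\<lambda>i. [a, b] ! (i mod 2)) ps = word j \<and> w = elt j)"
  by (simp add: reduced_subword_def reduced_word_iff numeral_2_eq_2)

text \<open>All reduced words for \<open>w\<close> have the same length, so
  \<open>lexord_upt\<close> compares the interval with every competitor.\<close>

lemma sorting_positions_uptI:
  assumes "reduced_subword G {a, b} [a, b] w [n..<n + k]"
    and "\<And>qs q. reduced_subword G {a, b} [a, b] w qs \<Longrightarrow> q \<in> set qs \<Longrightarrow> n \<le> q"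
  shows "sorting_positions G {a, b} [a, b] w [n..<n + k]"
  unfolding sorting_positions_def
proof (intro conjI allI impI assms(1))
  fix qs assume qs: "reduced_subword G {a, b} [a, b] w qs"
  then have "length qs = k"
    using assms(1) unfolding reduced_subword_def reduced_word_def
    by (metis add_diff_cancel_left' le_antisym length_map length_upt)
  with lexord_upt[of qs n] assms(2)[OF qs] qs
  show "[n..<n + k] = qs \<or> ([n..<n + k], qs) \<in> lexord {(i, j). i < j}"
    by (auto simp: reduced_subword_def)
qed

text \<open>The sorting word is an initial block of \<open>abab...\<close>, and two positions
  earlier the same letter stands in the preceding copy.\<close>

lemma sortable_nonneg:
  assumes "k \<le> m"
  shows "sortable G {a, b} [a, b] (elt (int k))"
  unfolding sortable_def
proof (intro conjI exI[of _ "[0..<0 + k]"] allI)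
  show "sorting_positions G {a, b} [a, b] (elt (int k)) [0..<0 + k]"
  proof (rule sorting_positions_uptI)
    show "reduced_subword G {a, b} [a, b] (elt (int k)) [0..<0 + k]"
      unfolding reduced_subword_iff map_alternating using assms
      by (auto intro!: exI[of _ "int k"] simp: word_def)
  qed simp
  fix i
  show "copy_letters [a, b] [0..<0 + k] (Suc i) \<subseteq> copy_letters [a, b] [0..<0 + k] i"
  proof
    fix x assume "x \<in> copy_letters [a, b] [0..<0 + k] (Suc i)"
    then obtain j where j: "x = [a, b] ! (j mod 2)" "j < k" "j div 2 = Suc i"
      by (auto simp: copy_letters_def numeral_2_eq_2)
    then have "j \<ge> 2" by linarith
    then have "(j - 2) mod 2 = j mod 2" "(j - 2) div 2 = i"
      using j(3) by (simp_all add: le_mod_geq le_div_geq)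
    with j show "x \<in> copy_letters [a, b] [0..<0 + k] i"
      unfolding copy_letters_def by (auto intro!: exI[of _ "j - 2"] simp: numeral_2_eq_2)
  qed
qed simp

text \<open>The only reduced word is \<open>b\<close>, while position \<open>0\<close> carries
  \<open>a\<close>; the earliest choice is position \<open>1\<close>, inside the first copy.\<close>

lemma sortable_atom: "sortable G {a, b} [a, b] (elt (-1))"
  unfolding sortable_def
proof (intro conjI exI[of _ "[1..<1 + 1]"] allI)
  show "sorting_positions G {a, b} [a, b] (elt (-1)) [1..<1 + 1]"
  proof (rule sorting_positions_uptI)
    show "reduced_subword G {a, b} [a, b] (elt (-1)) [1..<1 + 1]"
      unfolding reduced_subword_iff map_alternating using m_ge_2
      by (auto intro!: exI[of _ "-1"] simp: word_def)
    fix qs q assume "reduced_subword G {a, b} [a, b] (elt (-1)) qs" and q: "q \<in> set qs"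
    then obtain j where j: "\<bar>j\<bar> \<le> int m" "map (\<lambda>i. [a, b] ! (i mod 2)) qs = word j" "elt (-1) = elt j"
      by (auto simp: reduced_subword_iff)
    with elt_eq_imp[of "-1" j] m_ge_2 have "map (\<lambda>i. [a, b] ! (i mod 2)) qs = [b]"
      by (auto simp: word_def)
    with q have "[a, b] ! (q mod 2) = b" by auto
    with a_neq_b have "q \<noteq> 0" by (intro notI) simp
    then show "1 \<le> q" by simp
  qed
qed (auto simp: copy_letters_def)

text \<open>The reduced word starts with \<open>ba\<close>. Position \<open>0\<close> carries
  \<open>a\<close>, so it cannot serve the initial \<open>b\<close> and is skipped; the first copy
  then lacks \<open>a\<close>, although a later copy contributes it.\<close>

lemma not_sortable:
  assumes "- int m < j" "j \<le> -2"
  shows "\<not> sortable G {a, b} [a, b] (elt j)"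
proof
  assume "sortable G {a, b} [a, b] (elt j)"
  then obtain ps where red: "reduced_subword G {a, b} [a, b] (elt j) ps"
    and dec: "\<And>k. copy_letters [a, b] ps (Suc k) \<subseteq> copy_letters [a, b] ps k"
    by (auto simp: sortable_def sorting_positions_def)
  from red obtain i where "\<bar>i\<bar> \<le> int m" "map (\<lambda>i. [a, b] ! (i mod 2)) ps = word i" "elt j = elt i"
    by (auto simp: reduced_subword_iff)
  \<comment> \<open>Here \<open>|j| < m\<close> rules out a second representative, so the reduced
    word is unique.\<close>
  with elt_eq_imp[of j i] assms have word: "map (\<lambda>i. [a, b] ! (i mod 2)) ps = word j"
    by auto
  obtain n where "nat (- j) = Suc (Suc n)"
    using assms(2) by (intro that[of "nat (- j) - 2"]) auto
  then have "word j = b # a # alternating n b a"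
    using assms(2) by (simp add: word_def)
  with word obtain q r rs where ps: "ps = q # r # rs" "[a, b] ! (q mod 2) = b" "[a, b] ! (r mod 2) = a"
    by (auto simp: map_eq_Cons_conv)
  have "q \<noteq> 0" using ps(2) a_neq_b by (intro notI) simp
  then have pos: "0 \<notin> set ps"
    using red ps(1) by (auto simp: reduced_subword_def)
  have "copy_letters [a, b] ps k \<subseteq> copy_letters [a, b] ps 0" for k
    using dec by (rule lift_Suc_antimono_le) simp
  moreover have "a \<in> copy_letters [a, b] ps (r div 2)"
    using ps by (auto intro!: exI[of _ r] simp: copy_letters_def numeral_2_eq_2)
  ultimately have "a \<in> copy_letters [a, b] ps 0" by blast
  then obtain i where "i \<in> set ps" "i < 2" "[a, b] ! (i mod 2) = a"
    by (auto simp: copy_letters_def div_eq_0_iff numeral_2_eq_2)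
  with pos a_neq_b show False
    by (cases i) auto
qed

text \<open>\<open>not_sortable\<close> excludes the indices strictly between \<open>-m\<close> and
  \<open>-1\<close>, and \<open>-m\<close> names the same element as \<open>m\<close>.\<close>

lemma sortable_iff: "sortable G {a, b} [a, b] w \<longleftrightarrow> w \<in> elt ` {-1..int m}"
proof
  assume sort: "sortable G {a, b} [a, b] w"
  then obtain j where j: "\<bar>j\<bar> \<le> int m" "w = elt j"
    by (auto simp: sortable_def sorting_positions_def reduced_subword_iff)
  have "elt (- int m) = elt (int m)"
    by (simp add: elt_eq_iff cong_iff_dvd_diff)
  moreover have "j = - int m \<or> j \<ge> -1"
    using j(1) sort not_sortable[of j] unfolding j(2) by linarith
  ultimately show "w \<in> elt ` {-1..int m}"
    using j by (metis abs_le_D1 atLeastAtMost_iff imageI of_nat_0_le_iff order_trans neg_le_0_iff_le zero_le_one order_refl)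
next
  assume "w \<in> elt ` {-1..int m}"
  then obtain j where j: "-1 \<le> j" "j \<le> int m" "w = elt j" by auto
  then show "sortable G {a, b} [a, b] w"
    using sortable_atom sortable_nonneg[of "nat j"] by (cases "j = -1") auto
qed

text \<open>The atom \<open>b\<close> lies below the longest element through the reduced word
  starting with \<open>b\<close>, that is, through the representative \<open>-m\<close> of
  \<open>m\<close>.\<close>

lemma right_weak_le_elt_iff:
  assumes "i \<in> {-1..int m}" "k \<in> {-1..int m}"
  shows "right_weak_le G {a, b} (elt i) (elt k) \<longleftrightarrow> i = k \<or> i = 0 \<or> k = int m \<or> 0 \<le> i \<and> i \<le> k"
    (is "_ \<longleftrightarrow> ?R")
proof
  assume "right_weak_le G {a, b} (elt i) (elt k)"
  then obtain i' k' where *: "elt i = elt i'" "elt k = elt k'" "\<bar>k'\<bar> \<le> int m"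
      "0 \<le> i' \<and> i' \<le> k' \<or> k' \<le> i' \<and> i' \<le> 0"
    by (auto simp: right_weak_le_iff)
  have "int m \<ge> 2" using m_ge_2 by simp
  moreover from this have "i = i' \<or> i = - i' \<and> \<bar>i\<bar> = int m" "k = k' \<or> k = - k' \<and> \<bar>k\<bar> = int m"
    using elt_eq_imp[OF *(1)] elt_eq_imp[OF *(2)] *(3,4) assms unfolding atLeastAtMost_iff by arith+
  ultimately show ?R
    using *(3,4) assms unfolding atLeastAtMost_iff by arith
next
  have top: "elt (- int m) = elt (int m)"
    by (simp add: elt_eq_iff cong_iff_dvd_diff)
  assume ?R
  then consider "i = -1" "k = int m" | "i = k \<or> i = 0 \<or> 0 \<le> i \<and> i \<le> k"
    using assms by fastforce
  then show "right_weak_le G {a, b} (elt i) (elt k)"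
  proof cases
    case 1
    with m_ge_2 top show ?thesis
      unfolding right_weak_le_iff by (intro exI[of _ "-1"] exI[of _ "- int m"]) auto
  next
    case 2
    with assms m_ge_2 show ?thesis
      unfolding right_weak_le_iff by (intro exI[of _ i] exI[of _ k]) auto
  qed
qed

lemma inj_on_elt: "inj_on elt {-1..int m}"
  using elt_eq_imp m_ge_2 by (force simp: inj_on_def)

lemma polygon_lattice_camb: "polygon_lattice (camb G {a, b} [a, b]) elt m"
proof
  show "2 \<le> m" by (rule m_ge_2)
  show "inj_on elt {-1..int m}" by (rule inj_on_elt)
qed (auto simp: camb_def sortable_iff right_weak_le_elt_iff)

end

section \<open>Arbitrary Coxeter elements and their words\<close>

lemma dihedralI:
  assumes "dihedral_coxeter_system m G a b" "m \<ge> 2"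
  shows "dihedral G a b m"
proof -
  interpret group G
    using assms(1) by (simp add: dihedral_coxeter_system_def coxeter_system_def)
  show ?thesis
    by unfold_locales (use assms in auto)
qed

lemma dihedral_coxeter_system_commute:
  "dihedral_coxeter_system m G a b \<Longrightarrow> dihedral_coxeter_system m G b a"
  by (auto simp: dihedral_coxeter_system_def insert_commute)

theorem theorem1p19:
  fixes G :: "('a, 'b) monoid_scheme" and s t c :: 'a and cw :: "'a list"
    and m :: nat and p :: real
  assumes "m \<ge> 2"
    and "dihedral_coxeter_system m G s t"
    and "coxeter_element G {s, t} c"
    and "reduced_word G {s, t} c cw"
    and "0 < p" and "p \<le> 1"
  shows "ungarian_expectation (camb G {s, t} cw) p
           = ennreal ((1 + real m * (1 - p)) / (2 * p - p\<^sup>2))"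
proof -
  interpret dihedral G s t m
    using assms(1,2) by (intro dihedralI)
  obtain u where u: "distinct u" "set u = {s, t}" "word_val G u = c"
    using assms(3) by (auto simp: coxeter_element_def)
  then have "length u = 2"
    using distinct_card[of u] a_neq_b by simp
  then obtain x y where "u = [x, y]"
    by (auto simp: numeral_2_eq_2 length_Suc_conv)
  with u a_neq_b have "u = word 2 \<or> u = word (-2)"
    by (auto simp: word_def numeral_2_eq_2 doubleton_eq_iff)
  with u(3) obtain i :: int where i: "i = 2 \<or> i = -2" "c = elt i"
    using word_val_word by metis
  from assms(4) obtain j where j: "\<bar>j\<bar> \<le> int m" "cw = word j" "c = elt j"
    by (auto simp: reduced_word_iff)
  \<comment> \<open>For \<open>m = 2\<close> the generators commute and \<open>cw\<close> may spell
    \<open>c\<close> in the other order than \<open>u\<close>, so the sign of \<open>j\<close> can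
    differ from that of \<open>i\<close>.\<close>
  with i elt_eq_imp[of i j] m_ge_2 have "j = 2 \<or> j = -2" by auto
  with j(2) have "cw = [s, t] \<or> cw = [t, s]"
    by (auto simp: word_def numeral_2_eq_2)
  \<comment> \<open>Renames the generators so that \<open>cw\<close> is \<open>ab\<close>; the
    Coxeter system is symmetric in them.\<close>
  then obtain a b where ab: "cw = [a, b]" "{a, b} = {s, t}" "dihedral_coxeter_system m G a b"
    using assms(2) dihedral_coxeter_system_commute[OF assms(2)] by (metis insert_commute)
  interpret ab: dihedral G a b m
    using assms(1) ab(3) by (intro dihedralI)
  interpret camb: polygon_lattice "camb G {a, b} [a, b]" ab.elt m
    by (rule ab.polygon_lattice_camb)
  show ?thesis
    using camb.ungarian_expectation[OF assms(5,6)] unfolding ab by simp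
qed

end
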